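(* Let $n\ge1$ be an integer, let $\Sigma\in\mathbb{R}^{n\times n}$ be symmetric positive definite, and let $q\in\left(1,1+\frac2n\right)$. Consider the problem $$\max_{\phi\in L^q(\mathbb{R}^n)}\ -\int_{\mathbb{R}^n}\phi^q(x)\,dx$$ subject to $$\phi\ge0,\qquad \int_{\mathbb{R}^n}\phi(x)\,dx=1,\qquad \frac{\int_{\mathbb{R}^n}x\,\phi^q(x)\,dx}{\int_{\mathbb{R}^n}\phi^q(x)\,dx}=0,\qquad \frac{\int_{\mathbb{R}^n}xx^T\phi^q(x)\,dx}{\int_{\mathbb{R}^n}\phi^q(x)\,dx}=\Sigma .$$ The unique solution of this problem is $$p(x;q,\Sigma)=\frac{1}{|\pi\Sigma|^{1/2}}\cdot\frac{\Gamma\left(\frac1{q-1}\right)}{\Gamma\left(\frac1{q-1}-\frac n2\right)}\cdot\left(\frac{2}{q-1}-n\right)^{-\frac n2}\cdot\left(1+\left(\frac{2}{q-1}-n\right)^{-1}\langle x,\Sigma^{-1}x\rangle\right)^{\frac{1}{1-q}} .$$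
   Context: $|\cdot|$ applied to a matrix denotes the determinant, $\Gamma$ the Gamma function, $\langle\cdot,\cdot\rangle$ the Euclidean inner product. Uniqueness is as an element of $L^q(\mathbb{R}^n)$ (with respect to Lebesgue measure). The problem is the maximization of Tsallis entropy $S_q(\phi)=\frac{1}{q-1}\left(1-\int\phi^q\right)$ under normalization and first and second normalized $q$-moment constraints. *)

theory Defs
  imports "HOL-Analysis.Analysis"
begin

text \<open>
  Elements of \<open>L\<^sup>q\<close> are represented by Lebesgue measurable functions, to be identified when they
  agree almost everywhere.
\<close>

definition Lq :: "real \<Rightarrow> (real ^ 'n \<Rightarrow> real) set" where
  "Lq q = {\<phi> \<in> borel_measurable lebesgue. integrable lebesgue (\<lambda>x. \<bar>\<phi> x\<bar> powr q)}"

definition outer_self :: "real ^ 'n \<Rightarrow> real ^ 'n ^ 'n" where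
  "outer_self x = (\<chi> i j. x $ i * x $ j)"

definition pos_definite :: "real ^ 'n ^ 'n \<Rightarrow> bool" where
  "pos_definite A \<longleftrightarrow> (\<forall>x. x \<noteq> 0 \<longrightarrow> x \<bullet> (A *v x) > 0)"

text \<open>
  The Bochner integral of a non-integrable function is \<open>0\<close>, so the existence of each integral is
  required explicitly. The denominators do not vanish, since \<open>\<phi>\<close> is nonnegative with integral \<open>1\<close>.
\<close>

definition normalized_q_mean :: "real \<Rightarrow> (real ^ 'n \<Rightarrow> real) \<Rightarrow> real ^ 'n" where
  "normalized_q_mean q \<phi> =
     (\<integral>x. (\<phi> x powr q) *\<^sub>R x \<partial>lebesgue) /\<^sub>R (\<integral>x. \<phi> x powr q \<partial>lebesgue)"

definition normalized_q_second_moment :: "real \<Rightarrow> (real ^ 'n \<Rightarrow> real) \<Rightarrow> real ^ 'n ^ 'n" where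
  "normalized_q_second_moment q \<phi> =
     (\<integral>x. (\<phi> x powr q) *\<^sub>R outer_self x \<partial>lebesgue) /\<^sub>R (\<integral>x. \<phi> x powr q \<partial>lebesgue)"

definition feasible :: "real \<Rightarrow> real ^ 'n ^ 'n \<Rightarrow> (real ^ 'n \<Rightarrow> real) \<Rightarrow> bool" where
  "feasible q \<Sigma> \<phi> \<longleftrightarrow>
     \<phi> \<in> Lq q \<and>
     (AE x in lebesgue. \<phi> x \<ge> 0) \<and>
     integrable lebesgue \<phi> \<and> (\<integral>x. \<phi> x \<partial>lebesgue) = 1 \<and>
     integrable lebesgue (\<lambda>x. (\<phi> x powr q) *\<^sub>R x) \<and> normalized_q_mean q \<phi> = 0 \<and>
     integrable lebesgue (\<lambda>x. (\<phi> x powr q) *\<^sub>R outer_self x) \<and>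
     normalized_q_second_moment q \<phi> = \<Sigma>"

definition objective :: "real \<Rightarrow> (real ^ 'n \<Rightarrow> real) \<Rightarrow> real" where
  "objective q \<phi> = - (\<integral>x. \<phi> x powr q \<partial>lebesgue)"

definition tsallis_density :: "real \<Rightarrow> real ^ 'n ^ 'n \<Rightarrow> real ^ 'n \<Rightarrow> real" where
  "tsallis_density q \<Sigma> x =
     1 / sqrt (det (pi *\<^sub>R \<Sigma>))
     * (Gamma (1 / (q - 1)) / Gamma (1 / (q - 1) - real CARD('n) / 2))
     * (2 / (q - 1) - real CARD('n)) powr (- (real CARD('n) / 2))
     * (1 + inverse (2 / (q - 1) - real CARD('n)) * (x \<bullet> (matrix_inv \<Sigma> *v x))) powr (1 / (1 - q))"

end

theory Submission
  imports Defs
begin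

text \<open>
  Put \<open>Q x = \<langle>x, \<Sigma>\<^sup>-\<^sup>1 x\<rangle>\<close> and \<open>m = 2 / (q - 1) - n\<close>. The second moment constraint implies
  \<open>\<integral>Q \<phi>\<^sup>q = n \<integral>\<phi>\<^sup>q\<close>, hence \<open>\<integral>\<phi>\<^sup>q = \<integral>w \<phi>\<^sup>q\<close> for the weight \<open>w = (m + Q) / (m + n)\<close>. Since
  \<open>w p\<^bsup>q-1\<^esup>\<close> is a constant, integrating \<open>w\<close> times the tangent inequality
  \<open>\<phi>\<^sup>q \<ge> p\<^sup>q + q p\<^bsup>q-1\<^esup> (\<phi> - p)\<close> and using \<open>\<integral>\<phi> = \<integral>p\<close> gives \<open>\<integral>\<phi>\<^sup>q \<ge> \<integral>p\<^sup>q\<close>, and strict convexity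
  gives uniqueness. That \<open>p\<close> satisfies the constraints follows by substituting \<open>x = A y\<close> with
  \<open>A A\<^sup>T = m \<Sigma>\<close>, which turns \<open>p\<close> into a multiple of \<open>(1 + \<parallel>y\<parallel>\<^sup>2)\<^bsup>-1/(q-1)\<^esup>\<close>.
\<close>

section \<open>Linear change of variables\<close>

text \<open>With the coordinates other than the one along \<open>b\<close> held fixed, the shift is
  a constant because \<open>b' \<noteq> b\<close>. Fubini splits off that coordinate, and
  translation invariance on the line finishes.\<close>

lemma nn_integral_lborel_shear:
  fixes f :: "'a::euclidean_space \<Rightarrow> ennreal"
  assumes [measurable]: "f \<in> borel_measurable borel"
    and b: "b \<in> Basis" "b' \<in> Basis" "b \<noteq> b'"
  shows "(\<integral>\<^sup>+x. f (x + (c * (x \<bullet> b')) *\<^sub>R b) \<partial>lborel) = (\<integral>\<^sup>+x. f x \<partial>lborel)"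
proof -
  interpret product_sigma_finite "\<lambda>_::'a. lborel :: real measure" by standard
  define B where "B = (Basis - {b} :: 'a set)"
  define S where "S g = (\<Sum>i\<in>B. g i *\<^sub>R i)" for g :: "'a \<Rightarrow> real"
  have B: "finite B" "b \<notin> B" "Basis = insert b B" "b' \<in> B"
    using b by (auto simp: B_def)
  have S_upd: "(\<Sum>i\<in>insert b B. (g(b := y)) i *\<^sub>R i) = S g + y *\<^sub>R b" for g y
  proof -
    have "(\<Sum>i\<in>B. (g(b := y)) i *\<^sub>R i) = S g"
      unfolding S_def using B(2) by (intro sum.cong) auto
    then show ?thesis using B(1,2) by simp
  qed
  have S_b': "S g \<bullet> b' = g b'" for g
  proof -
    have "S g \<bullet> b' = (\<Sum>i\<in>B. if i = b' then g i else 0)"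
      unfolding S_def inner_sum_left using b
      by (intro sum.cong) (auto simp: B_def inner_Basis)
    then show ?thesis using B by simp
  qed
  have split: "(\<integral>\<^sup>+x. h x \<partial>lborel) =
      (\<integral>\<^sup>+g. (\<integral>\<^sup>+y. h (S g + y *\<^sub>R b) \<partial>lborel) \<partial>PiM B (\<lambda>_. lborel))"
    if [measurable]: "h \<in> borel_measurable borel" for h :: "'a \<Rightarrow> ennreal"
  proof -
    have [measurable]: "(\<lambda>g. \<Sum>i\<in>insert b B. g i *\<^sub>R i) \<in> borel_measurable (PiM (insert b B) (\<lambda>_. lborel))"
      by measurable
    have "(\<integral>\<^sup>+x. h x \<partial>lborel) =
        (\<integral>\<^sup>+g. h (\<Sum>i\<in>insert b B. g i *\<^sub>R i) \<partial>PiM (insert b B) (\<lambda>_. lborel))"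
      by (subst lborel_eq, subst nn_integral_distr) (simp_all add: B(3))
    also have "\<dots> = (\<integral>\<^sup>+g. (\<integral>\<^sup>+y. h (S g + y *\<^sub>R b) \<partial>lborel) \<partial>PiM B (\<lambda>_. lborel))"
      using B(1,2) by (subst product_nn_integral_insert) (simp_all only: S_upd, measurable)
    finally show ?thesis .
  qed
  have "(\<integral>\<^sup>+x. f (x + (c * (x \<bullet> b')) *\<^sub>R b) \<partial>lborel) =
      (\<integral>\<^sup>+g. (\<integral>\<^sup>+y. f (S g + (c * g b' + 1 * y) *\<^sub>R b) \<partial>lborel) \<partial>PiM B (\<lambda>_. lborel))"
    using b by (subst split) (simp_all add: inner_add_left S_b' inner_Basis algebra_simps)
  also have "\<dots> = (\<integral>\<^sup>+g. (\<integral>\<^sup>+y. f (S g + y *\<^sub>R b) \<partial>lborel) \<partial>PiM B (\<lambda>_. lborel))"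
    using nn_integral_real_affine[of "\<lambda>y. f (S g + y *\<^sub>R b)" 1 "c * g b'" for g]
    by simp
  also have "\<dots> = (\<integral>\<^sup>+x. f x \<partial>lborel)"
    by (simp add: split)
  finally show ?thesis .
qed

text \<open>The preimage of a box is a box with bounds permuted by \<open>inv p\<close>, and
  reindexing the product of side lengths shows that the volumes agree.\<close>

lemma lborel_distr_permute_coordinates:
  fixes p :: "'n::finite \<Rightarrow> 'n"
  assumes p: "p permutes UNIV"
  shows "distr lborel borel (\<lambda>x::real^'n. \<chi> i. x $ p i) = lborel"
proof (rule lborel_eqI[symmetric], goal_cases)
  case (1 l u)
  have bij: "bij p" using p by (rule permutes_bij)
  have meas [measurable]: "(\<lambda>x::real^'n. \<chi> i. x $ p i) \<in> borel \<rightarrow>\<^sub>M borel"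
    by (intro borel_measurable_continuous_onI continuous_intros)
  have vim: "(\<lambda>x::real^'n. \<chi> i. x $ p i) -` box l u = box (\<chi> i. l $ inv p i) (\<chi> i. u $ inv p i)"
    using bij by (auto simp: mem_box_cart) (metis bij_inv_eq_iff)+
  have le: "l $ i \<le> u $ i" for i
    using 1[of "axis i 1"] by (simp add: cart_eq_inner_axis axis_in_Basis_iff)
  have "(\<Prod>b\<in>Basis. (v - w) \<bullet> b) = (\<Prod>i\<in>UNIV. v $ i - w $ i)" for v w :: "real^'n"
    by (simp add: Basis_vec_def UNION_singleton_eq_range prod.reindex inj_on_def axis_eq_axis
      flip: cart_eq_inner_axis)
  moreover have "(\<Prod>i\<in>UNIV. u $ inv p i - l $ inv p i) = (\<Prod>i\<in>UNIV. u $ i - l $ i)"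
    using bij by (intro prod.reindex_bij_betw[of "inv p"]) (simp add: bij_imp_bij_inv)
  ultimately show ?case
    using le by (simp add: emeasure_distr vim emeasure_lborel_box_eq cart_eq_inner_axis[symmetric] Basis_vec_def)
qed simp

text \<open>
  The change of variables theorems of the library require a well-ordered index type. Induction over
  elementary matrices gives the linear case for every finite index type.
\<close>

lemma nn_integral_lborel_linear:
  fixes M :: "real^'n^'n" and f :: "real^'n \<Rightarrow> ennreal"
  assumes f: "f \<in> borel_measurable borel" and M: "det M \<noteq> 0"
  shows "(\<integral>\<^sup>+x. f x \<partial>lborel) = ennreal \<bar>det M\<bar> * (\<integral>\<^sup>+x. f (M *v x) \<partial>lborel)"
  using assms
proof (induction M arbitrary: f 
    rule: induct_matrix_elementary[case_names mult zero_row diagonal swap1 idplus])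
  case (mult A B)
  have [measurable]: "(\<lambda>x. f (A *v x)) \<in> borel_measurable borel"
    using mult.prems(1) by (intro measurable_compose[OF _ mult.prems(1)]
      borel_measurable_continuous_onI continuous_intros)
  show ?case
    using mult.prems mult.IH(1)[of f] mult.IH(2)[of "\<lambda>x. f (A *v x)"]
    by (simp add: det_mul abs_mult ennreal_mult matrix_vector_mul_assoc mult.assoc)
next
  case (zero_row A i)
  then show ?case by (simp add: det_zero_row row_def)
next
  case (diagonal A)
  have det: "det A = (\<Prod>i\<in>UNIV. A $ i $ i)"
    by (rule det_diagonal) (use diagonal.hyps in auto)
  \<comment> \<open>The affine substitution rule for \<open>lborel\<close> indexes its scale factors
    by basis vectors, so the diagonal entries become a function on \<open>Basis\<close>. The
    \<open>0\<close> in \<open>T\<close> below is the translation part of that rule.\<close>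
  define c where "c b = (A *v b) \<bullet> b" for b
  have c_axis: "c (axis i 1) = A $ i $ i" for i
    by (simp add: c_def matrix_vector_mult_basis column_def flip: cart_eq_inner_axis)
  have Basis: "Basis = (\<lambda>i. axis i (1::real)) ` (UNIV :: 'n set)"
    by (auto simp: Basis_vec_def)
  have inj: "inj (\<lambda>i::'n. axis i (1::real))"
    by (auto simp: inj_on_def axis_eq_axis)
  have ax: "axis i (1::real) $ k = (if k = i then 1 else 0)" for i k :: 'n
    by (simp add: axis_def)
  have T: "0 + (\<Sum>j\<in>Basis. (c j * (x \<bullet> j)) *\<^sub>R j) = A *v x" for x
  proof -
    have "(A *v x) $ k = (\<Sum>j\<in>UNIV. if j = k then A $ k $ k * x $ k else 0)" for k
      unfolding matrix_vector_mult_def vec_lambda_beta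
      using diagonal.hyps[of k] by (intro sum.cong) auto
    moreover have "(\<Sum>j\<in>Basis. (c j * (x \<bullet> j)) *\<^sub>R j) $ k = A $ k $ k * x $ k" for k
      unfolding Basis
      by (subst sum.reindex[OF inj])
        (simp add: c_axis ax cart_eq_inner_axis[symmetric] if_distrib cong: if_cong)
    ultimately show ?thesis by (simp add: vec_eq_iff)
  qed
  have "lborel = density (distr lborel borel (\<lambda>x. A *v x)) (\<lambda>_. \<Prod>j\<in>Basis. \<bar>c j\<bar>)"
    unfolding T[symmetric]
    by (rule lborel_affine_euclidean) (use diagonal.prems(2) in \<open>auto simp: Basis c_axis det\<close>)
  also have "(\<Prod>j\<in>Basis. \<bar>c j\<bar>) = \<bar>det A\<bar>"
    unfolding Basis by (subst prod.reindex[OF inj]) (simp add: c_axis det abs_prod)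
  finally have eq: "lborel = density (distr lborel borel (\<lambda>x. A *v x)) (\<lambda>_. ennreal \<bar>det A\<bar>)" .
  have [measurable]: "(\<lambda>x. A *v x) \<in> borel \<rightarrow>\<^sub>M borel" "f \<in> borel_measurable borel"
    using diagonal.prems by (auto intro!: borel_measurable_continuous_onI continuous_intros)
  show ?case
    by (subst eq) (simp add: nn_integral_density nn_integral_distr nn_integral_cmult)
next
  case (swap1 m n)
  let ?p = "Transposition.transpose m n"
  have p: "?p permutes UNIV" by (rule permutes_swap_id) auto
  have [measurable]: "(\<lambda>x::real^'n. \<chi> i. x $ ?p i) \<in> borel \<rightarrow>\<^sub>M borel"
    by (intro borel_measurable_continuous_onI continuous_intros)
  have det: "\<bar>det (\<chi> i j. mat 1 $ i $ ?p j :: real^'n^'n)\<bar> = 1"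
    using det_permute_columns[OF p, of "mat 1 :: real^'n^'n"] by (simp add: sign_def)
  have mv: "(\<chi> i j. mat 1 $ i $ ?p j) *v x = (\<chi> i. x $ ?p i)" for x :: "real^'n"
  proof -
    have "(\<Sum>j\<in>UNIV. (if i = ?p j then 1 else 0) * x $ j) = x $ ?p i" for i
    proof -
      have "i = ?p j \<longleftrightarrow> j = ?p i" for j by (metis transpose_involutory)
      then show ?thesis by (simp only: if_distrib[of "\<lambda>z. z * _"] mult_1 mult_zero_left) simp
    qed
    then show ?thesis by (simp add: matrix_vector_mult_def mat_def vec_eq_iff)
  qed
  have "(\<integral>\<^sup>+x. f x \<partial>lborel) = (\<integral>\<^sup>+x. f (\<chi> i. x $ ?p i) \<partial>lborel)"
    using swap1.prems
    by (subst lborel_distr_permute_coordinates[OF p, symmetric]) (simp add: nn_integral_distr)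
  then show ?case by (simp add: mv det)
next
  case (idplus m n c)
  let ?A = "\<chi> i j. if i = m \<and> j = n then c else of_bool (i = j) :: real^'n^'n"
  \<comment> \<open>The matrix arises from the identity by adding \<open>c\<close> times row
    \<open>n\<close> to row \<open>m\<close>, which preserves the determinant; on vectors it acts as
    a shear.\<close>
  have A: "?A = (\<chi> k. if k = m then row m (mat 1) + c *s row n (mat 1) else row k (mat 1))"
    using idplus.hyps by (auto simp: vec_eq_iff row_def mat_def)
  have det: "det ?A = 1"
    unfolding A by (subst det_row_operation) (use idplus.hyps in auto)
  have mv: "?A *v x = x + (c * (x \<bullet> axis n 1)) *\<^sub>R axis m 1" for x
  proof -
    have "(\<Sum>j\<in>UNIV. (if i = m \<and> j = n then c else of_bool (i = j)) * x $ j) =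
       x $ i + (if i = m then c * x $ n else 0)" for i
    proof -
      have "(\<Sum>j\<in>UNIV. (if i = m \<and> j = n then c else of_bool (i = j)) * x $ j) =
         (\<Sum>j\<in>UNIV. (if j = i then x $ i else 0) + (if j = n then if i = m then c * x $ n else 0 else 0))"
        using idplus.hyps by (intro sum.cong) auto
      then show ?thesis by (simp add: sum.distrib)
    qed
    then show ?thesis
      unfolding cart_eq_inner_axis[symmetric]
      by (auto simp: vec_eq_iff matrix_vector_mult_def axis_def)
  qed
  show ?case
    unfolding mv det
    by (subst nn_integral_lborel_shear) (use idplus in \<open>auto simp: axis_in_Basis_iff axis_eq_axis\<close>)
qed

text \<open>Testing the previous formula on indicators gives an identity of measures, from which
  Bochner integrals are handled by the rules for densities and image measures.\<close>

lemma lborel_linear: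
  fixes M :: "real^'n^'n"
  assumes M: "det M \<noteq> 0"
  shows "lborel = density (distr lborel borel (\<lambda>x. M *v x)) (\<lambda>_. ennreal \<bar>det M\<bar>)"
proof (rule measure_eqI)
  fix X assume "X \<in> sets (lborel :: (real^'n) measure)"
  then have [measurable]: "X \<in> sets borel" by simp
  have [measurable]: "(\<lambda>x. M *v x) \<in> borel \<rightarrow>\<^sub>M borel"
    by (intro borel_measurable_continuous_onI continuous_intros)
  show "emeasure lborel X =
      emeasure (density (distr lborel borel (\<lambda>x. M *v x)) (\<lambda>_. ennreal \<bar>det M\<bar>)) X"
    using nn_integral_lborel_linear[OF _ M, of "indicator X"]
    by (simp add: emeasure_density nn_integral_cmult nn_integral_distr del: nn_integral_indicator
      flip: nn_integral_indicator[of X lborel])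
qed simp

lemma
  fixes M :: "real^'n^'n" and f :: "real^'n \<Rightarrow> 'b::{banach, second_countable_topology}"
  assumes f: "f \<in> borel_measurable borel" and M: "det M \<noteq> 0"
  shows integrable_lborel_linear_iff:
      "integrable lborel f \<longleftrightarrow> integrable lborel (\<lambda>x. f (M *v x))"
    and integral_lborel_linear:
      "integral\<^sup>L lborel f = \<bar>det M\<bar> *\<^sub>R (\<integral>x. f (M *v x) \<partial>lborel)"
proof -
  have [measurable]: "(\<lambda>x. M *v x) \<in> borel \<rightarrow>\<^sub>M borel" "f \<in> borel_measurable borel"
    using f by (auto intro!: borel_measurable_continuous_onI continuous_intros)
  have "integrable lborel (\<lambda>x. f (M *v x))" if "integrable lborel (\<lambda>x. \<bar>det M\<bar> *\<^sub>R f (M *v x))"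
    using integrable_scaleR_right[OF that, of "inverse \<bar>det M\<bar>"] M by simp
  then have scale: "integrable lborel (\<lambda>x. \<bar>det M\<bar> *\<^sub>R f (M *v x)) \<longleftrightarrow>
      integrable lborel (\<lambda>x. f (M *v x))"
    by auto
  show "integrable lborel f \<longleftrightarrow> integrable lborel (\<lambda>x. f (M *v x))"
    by (subst lborel_linear[OF M])
      (simp add: integrable_density integrable_distr_eq scale)
  show "integral\<^sup>L lborel f = \<bar>det M\<bar> *\<^sub>R (\<integral>x. f (M *v x) \<partial>lborel)"
    by (subst lborel_linear[OF M]) (simp add: integral_density integral_distr)
qed

section \<open>Positive definite matrices and powers\<close>

lemma symmetric_matrix_inner:
  fixes M :: "real^'n^'n"
  assumes "transpose M = M"
  shows "x \<bullet> (M *v y) = (M *v x) \<bullet> y"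
  using assms by (metis dot_lmul_matrix vector_transpose_matrix)

text \<open>Gram-Schmidt for the inner product \<open>x \<bullet> (M *v y)\<close> yields an
  orthonormal basis. With its vectors as the rows of \<open>V\<close>,
  \<open>V ** M ** transpose V = mat 1\<close>, and the inverse of \<open>V\<close> is the required
  factor.\<close>

lemma pos_definite_factorization:
  fixes M :: "real^'n^'n"
  assumes sym: "transpose M = M" and pos: "pos_definite M"
  obtains A :: "real^'n^'n" where "M = A ** transpose A" "invertible A"
proof -
  have "\<exists>v :: 'n \<Rightarrow> real^'n. \<forall>i\<in>I. \<forall>j\<in>I. v i \<bullet> (M *v v j) = (if i = j then 1 else 0)"
    for I :: "'n set"
    using finite[of I]
  proof (induction I rule: finite_induct)
    case (insert k I)
    then obtain v where v: "\<And>i j. i \<in> I \<Longrightarrow> j \<in> I \<Longrightarrow> v i \<bullet> (M *v v j) = (if i = j then 1 else 0)"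
      by blast
    \<comment> \<open>Fewer than \<open>CARD('n)\<close> vectors cannot span the space, so some
      \<open>x\<close> is left to orthogonalize.\<close>
    have "dim (v ` I) \<le> card I"
      by (rule order.trans[OF dim_le_card']) (use insert.hyps in \<open>auto intro: card_image_le\<close>)
    also have "card I < card (UNIV :: 'n set)"
      using insert.hyps by (intro psubset_card_mono) auto
    finally have "span (v ` I) \<noteq> UNIV"
      by (metis dim_span dim_UNIV DIM_cart DIM_real mult.right_neutral less_irrefl)
    then obtain x where x: "x \<notin> span (v ` I)" by blast
    define y where "y = x - (\<Sum>j\<in>I. (x \<bullet> (M *v v j)) *\<^sub>R v j)"
    have "(\<Sum>j\<in>I. (x \<bullet> (M *v v j)) *\<^sub>R v j) \<in> span (v ` I)"
      by (intro span_sum span_scale span_base) auto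
    with x have "y \<noteq> 0" unfolding y_def by auto
    then have y_pos: "y \<bullet> (M *v y) > 0" using pos by (simp add: pos_definite_def)
    have orth: "y \<bullet> (M *v v i) = 0" if "i \<in> I" for i
      using that insert.hyps
      by (simp add: y_def inner_diff_left inner_sum_left v if_distrib cong: if_cong)
    have orth': "v i \<bullet> (M *v y) = 0" if "i \<in> I" for i
      using orth[OF that] by (metis symmetric_matrix_inner[OF sym] inner_commute)
    define z where "z = y /\<^sub>R sqrt (y \<bullet> (M *v y))"
    have "z \<bullet> (M *v z) = (y \<bullet> (M *v y)) / (sqrt (y \<bullet> (M *v y)))\<^sup>2"
      by (simp add: z_def matrix_vector_mult_scaleR power2_eq_square divide_simps)
    then have "z \<bullet> (M *v z) = 1" using y_pos by simp
    moreover have "z \<bullet> (M *v v i) = 0" "v i \<bullet> (M *v z) = 0" if "i \<in> I" for i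
      using orth[OF that] orth'[OF that] by (simp_all add: z_def matrix_vector_mult_scaleR)
    ultimately have "\<forall>i\<in>insert k I. \<forall>j\<in>insert k I.
        (v(k := z)) i \<bullet> (M *v (v(k := z)) j) = (if i = j then 1 else 0)"
      using v insert.hyps by auto
    then show ?case by blast
  qed simp
  from this[of UNIV] obtain v :: "'n \<Rightarrow> real^'n"
    where v: "\<And>i j. v i \<bullet> (M *v v j) = (if i = j then 1 else 0)" by auto
  define V where "V = (\<chi> i. v i)"
  have VMV: "V ** M ** transpose V = mat 1"
  proof -
    have "(V ** (M ** transpose V)) $ i $ j = v i \<bullet> (M *v v j)" for i j
      by (simp add: V_def matrix_matrix_mult_def matrix_vector_mult_def transpose_def inner_vec_def)
    then show ?thesis by (simp add: vec_eq_iff v mat_def matrix_mul_assoc)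
  qed
  then have "invertible V"
    by (metis invertible_right_inverse matrix_mul_assoc)
  then obtain A where A: "A ** V = mat 1" "V ** A = mat 1" by (auto simp: invertible_def)
  have inv: "invertible A" using A by (auto simp: invertible_def)
  have "M = A ** transpose A"
  proof -
    have "M = (A ** V) ** M ** transpose (A ** V)"
      using A by (simp add: transpose_mat)
    also have "\<dots> = A ** (V ** M ** transpose V) ** transpose A"
      by (simp add: matrix_transpose_mul matrix_mul_assoc)
    finally show "M = A ** transpose A" by (simp add: VMV)
  qed
  then show ?thesis using that inv by blast
qed

section \<open>Tangent inequality for powers\<close>

text \<open>Strict convexity in tangent-line form. Homogeneity reduces it to the tangent at
  \<open>1\<close>, where it combines \<open>1 + x \<le> exp x\<close> with
  \<open>ln x \<le> x - 1\<close>.\<close>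

lemma powr_tangent_le:
  fixes s r q :: real
  assumes "1 < q" "0 \<le> s" "0 < r"
  shows "r powr q + q * r powr (q - 1) * (s - r) \<le> s powr q" (is ?le)
    and "r powr q + q * r powr (q - 1) * (s - r) = s powr q \<Longrightarrow> s = r"
proof -
  have unit: "1 + q * (u - 1) \<le> u powr q" "1 + q * (u - 1) = u powr q \<Longrightarrow> u = 1"
    if "0 \<le> u" for u :: real
  proof -
    have *: "1 + q * (u - 1) \<le> u powr q \<and> (1 + q * (u - 1) = u powr q \<longrightarrow> u = 1)"
    \<comment> \<open>The logarithmic estimate needs \<open>u > 0\<close>; at \<open>u = 0\<close>
      the claim amounts to \<open>1 - q < 0\<close>, as \<open>0 powr q = 0\<close>.\<close>
    proof (cases "u = 0")
      case True
      then show ?thesis using assms by simp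
    next
      case False
      with that have u: "u > 0" by simp
      have "1 + (q - 1) * ln u \<le> u powr (q - 1)"
        using exp_ge_add_one_self[of "(q - 1) * ln u"] u by (simp add: powr_def)
      then have "u * (1 + (q - 1) * ln u) \<le> u * u powr (q - 1)"
        using u by (intro mult_left_mono) auto
      also have "u * u powr (q - 1) = u powr q"
        using u by (simp add: powr_mult_base)
      finally have 1: "u * (1 + (q - 1) * ln u) \<le> u powr q" .
      \<comment> \<open>The gap between the logarithmic lower bound and the tangent line is
        nonnegative and vanishes only at \<open>u = 1\<close>, which settles the equality case
        too.\<close>
      have 2: "u * (1 + (q - 1) * ln u) - (1 + q * (u - 1)) = (q - 1) * (u * ln u - u + 1)"
        by (simp add: algebra_simps)
      have 3: "u * ln u - u + 1 = u * (inverse u - 1 - ln (inverse u))"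
        using u by (simp add: ln_inverse algebra_simps)
      have 4: "inverse u - 1 - ln (inverse u) \<ge> 0"
        using ln_le_minus_one[of "inverse u"] u by simp
      have nonneg: "(q - 1) * (u * ln u - u + 1) \<ge> 0"
        unfolding 3 using u 4 assms by (intro mult_nonneg_nonneg) auto
      have "u = 1" if "(q - 1) * (u * ln u - u + 1) = 0"
      proof -
        have "ln (inverse u) = inverse u - 1"
          using that u assms unfolding 3 by auto
        then have "inverse u = 1" using u by (intro ln_eq_minus_one) auto
        then show ?thesis by simp
      qed
      with 1 2 nonneg show ?thesis by (smt (verit))
    qed
    then show "1 + q * (u - 1) \<le> u powr q" "1 + q * (u - 1) = u powr q \<Longrightarrow> u = 1"
      by blast+
  qed
  have "s powr q = (r * (s / r)) powr q" using assms by simp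
  also have "\<dots> = r powr q * (s / r) powr q"
    using assms by (subst powr_mult) auto
  finally have s: "s powr q = r powr q * (s / r) powr q" .
  have "r powr q = r * r powr (q - 1)" using assms by (simp add: powr_mult_base)
  then have l: "r powr q + q * r powr (q - 1) * (s - r) = r powr q * (1 + q * (s / r - 1))"
    using assms by (simp add: field_simps)
  show ?le unfolding s l using unit(1)[of "s / r"] assms by (intro mult_left_mono) auto
  assume "r powr q + q * r powr (q - 1) * (s - r) = s powr q"
  then have "1 + q * (s / r - 1) = (s / r) powr q"
    unfolding s l using assms by simp
  from unit(2)[OF _ this] assms show "s = r" by simp
qed

section \<open>Student integrals\<close>

text \<open>Euler's integral after substituting \<open>c * t\<close> for \<open>t\<close>. It serves
  both the Gaussian integral and the mixture representation of the Student function.\<close>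

lemma nn_integral_Gamma_scaled:
  fixes s c :: real
  assumes s: "s > 0" and c: "c > 0"
  shows "(\<integral>\<^sup>+t. ennreal (indicator {0..} t * t powr (s - 1) * exp (- (c * t))) \<partial>lborel) =
    ennreal (Gamma s * c powr (- s))"
proof -
  have "ennreal (Gamma s) = (\<integral>\<^sup>+t. ennreal (indicator {0..} t * t powr (s - 1) / exp t) \<partial>lborel)"
    by (rule Gamma_conv_nn_integral_real[OF s])
  also have "\<dots> = ennreal c * (\<integral>\<^sup>+t. ennreal (indicator {0..} (c * t) * (c * t) powr (s - 1) / exp (c * t)) \<partial>lborel)"
    using c by (subst nn_integral_real_affine[where c=c and t=0]) auto
  also have "(\<lambda>t. ennreal (indicator {0..} (c * t) * (c * t) powr (s - 1) / exp (c * t))) =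
      (\<lambda>t. ennreal (c powr (s - 1)) * ennreal (indicator {0..} t * t powr (s - 1) * exp (- (c * t))))"
    using c by (intro ext)
      (auto simp: indicator_def zero_le_mult_iff powr_mult exp_minus field_simps simp flip: ennreal_mult')
  finally have "ennreal (Gamma s) = ennreal c * (ennreal (c powr (s - 1)) *
      (\<integral>\<^sup>+t. ennreal (indicator {0..} t * t powr (s - 1) * exp (- (c * t))) \<partial>lborel))"
    by (simp add: nn_integral_cmult)
  also have "\<dots> = ennreal (c powr s) *
      (\<integral>\<^sup>+t. ennreal (indicator {0..} t * t powr (s - 1) * exp (- (c * t))) \<partial>lborel)"
    using c by (simp add: powr_mult_base flip: mult.assoc ennreal_mult')
  finally have "ennreal (c powr (- s)) * ennreal (Gamma s) = ennreal (c powr (- s)) * ennreal (c powr s) *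
      (\<integral>\<^sup>+t. ennreal (indicator {0..} t * t powr (s - 1) * exp (- (c * t))) \<partial>lborel)"
    by (simp add: mult.assoc)
  also have "ennreal (c powr (- s)) * ennreal (c powr s) = 1"
    using c by (simp add: powr_minus flip: ennreal_mult')
  finally show ?thesis
    using s by (simp add: mult.commute[of "Gamma s"] ennreal_mult')
qed

lemma nn_integral_gaussian:
  fixes t :: real
  assumes t: "t > 0"
  shows "(\<integral>\<^sup>+(x::'a::euclidean_space). ennreal (exp (- (t * (norm x)\<^sup>2))) \<partial>lborel) =
    ennreal ((pi / t) powr (DIM('a) / 2))"
proof -
  define n where "n = real DIM('a)"
  have n: "n > 0" by (simp add: n_def)
  \<comment> \<open>The layer cake formula reduces the integral to volumes of balls.\<close>
  have layer: "ennreal (exp (- (t * r))) =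
      (\<integral>\<^sup>+s. ennreal (t * exp (- (t * s))) * indicator {r..} s \<partial>lborel)" for r
  proof -
    have "((\<lambda>s. - exp (- (t * s))) \<longlongrightarrow> - 0) at_top"
      using t by (intro tendsto_minus filterlim_compose[OF exp_at_bot])
        (simp add: filterlim_uminus_at_bot filterlim_tendsto_pos_mult_at_top[OF tendsto_const] filterlim_ident)
    then show ?thesis
      using t by (subst nn_integral_FTC_atLeast[where F="\<lambda>s. - exp (- (t * s))" and T="- 0"])
        (auto intro!: derivative_eq_intros)
  qed
  have "(\<integral>\<^sup>+(x::'a). ennreal (exp (- (t * (norm x)\<^sup>2))) \<partial>lborel) =
      (\<integral>\<^sup>+(x::'a). (\<integral>\<^sup>+s. ennreal (t * exp (- (t * s))) * (if (norm x)\<^sup>2 \<le> s then 1 else 0) \<partial>lborel) \<partial>lborel)"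
    by (simp add: layer indicator_def of_bool_def)
  also have "\<dots> =
      (\<integral>\<^sup>+s. (\<integral>\<^sup>+(x::'a). ennreal (t * exp (- (t * s))) * (if (norm x)\<^sup>2 \<le> s then 1 else 0) \<partial>lborel) \<partial>lborel)"
    by (rule lborel_pair.Fubini'[symmetric]) measurable
  \<comment> \<open>For \<open>s \<ge> 0\<close> the inner set is a ball of radius
    \<open>sqrt s\<close>; for negative \<open>s\<close> it is empty, hence the indicator. The
    exponent \<open>(n / 2 + 1) - 1\<close> is written to match the Gamma integral with parameter
    \<open>n / 2 + 1\<close>.\<close>
  also have "\<dots> = (\<integral>\<^sup>+s. ennreal (unit_ball_vol n * t) *
      ennreal (indicator {0..} s * s powr ((n / 2 + 1) - 1) * exp (- (t * s))) \<partial>lborel)"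
  proof (intro nn_integral_cong)
    fix s :: real
    have "(\<integral>\<^sup>+(x::'a). (if (norm x)\<^sup>2 \<le> s then 1 else 0) \<partial>lborel) =
        ennreal (indicator {0..} s * unit_ball_vol n * s powr (n / 2))"
    proof (cases "s \<ge> 0")
      case True
      have "(norm x)\<^sup>2 \<le> s \<longleftrightarrow> x \<in> cball 0 (sqrt s)" for x :: 'a
        using real_sqrt_le_iff[of "(norm x)\<^sup>2" s] by simp
      then have "(\<integral>\<^sup>+(x::'a). (if (norm x)\<^sup>2 \<le> s then 1 else 0) \<partial>lborel) =
          (\<integral>\<^sup>+(x::'a). indicator (cball 0 (sqrt s)) x \<partial>lborel)"
        by (intro nn_integral_cong) (simp add: indicator_def)
      also have "\<dots> = ennreal (unit_ball_vol n * sqrt s ^ DIM('a))"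
        using True by (simp add: emeasure_cball n_def)
      also have "sqrt s ^ DIM('a) = s powr (n / 2)"
        using True by (cases "s = 0")
          (simp_all add: n_def powr_half_sqrt[symmetric] powr_powr flip: powr_realpow)
      finally show ?thesis using True by simp
    next
      case False
      then have "\<not> (norm x)\<^sup>2 \<le> s" for x :: 'a
        by (meson order.trans zero_le_power2)
      then show ?thesis using False by simp
    qed
    then show "(\<integral>\<^sup>+(x::'a). ennreal (t * exp (- (t * s))) * (if (norm x)\<^sup>2 \<le> s then 1 else 0) \<partial>lborel) =
        ennreal (unit_ball_vol n * t) *
        ennreal (indicator {0..} s * s powr ((n / 2 + 1) - 1) * exp (- (t * s)))"
      using t n by (subst nn_integral_cmult) (auto simp: ac_simps simp flip: ennreal_mult')
  qed
  also have "\<dots> = ennreal (unit_ball_vol n * t) * ennreal (Gamma (n / 2 + 1) * t powr (- (n / 2 + 1)))"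
    using t n by (subst nn_integral_cmult, measurable) (subst nn_integral_Gamma_scaled, auto)
  \<comment> \<open>\<open>unit_ball_vol n\<close> has \<open>Gamma (n / 2 + 1)\<close> in its
    denominator, which cancels the factor just produced.\<close>
  also have "\<dots> = ennreal ((pi / t) powr (n / 2))"
  proof -
    have "Gamma (n / 2 + 1) > 0" using n by (intro Gamma_real_pos) auto
    moreover have "t * t powr (- (n / 2 + 1)) = t powr (- (n / 2))"
      using t by (simp add: powr_mult_base)
    ultimately have "unit_ball_vol n * t * (Gamma (n / 2 + 1) * t powr (- (n / 2 + 1))) =
        pi powr (n / 2) * t powr (- (n / 2))"
      by (simp add: unit_ball_vol_def)
    also have "\<dots> = (pi / t) powr (n / 2)"
      using t by (simp add: powr_divide powr_minus field_simps)
    finally show ?thesis using t n by (simp flip: ennreal_mult')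
  qed
  finally show ?thesis by (simp add: n_def)
qed

lemma nn_integral_student:
  fixes a :: real
  assumes a: "a > DIM('a::euclidean_space) / 2"
  shows "(\<integral>\<^sup>+(x::'a). ennreal ((1 + (norm x)\<^sup>2) powr (- a)) \<partial>lborel) =
    ennreal (pi powr (DIM('a) / 2) * Gamma (a - DIM('a) / 2) / Gamma a)"
proof -
  define n where "n = real DIM('a)"
  have n: "n > 0" "a > n / 2" using a by (simp_all add: n_def)
  then have a0: "a > 0" by linarith
  have Ga: "Gamma a > 0" using a0 by (rule Gamma_real_pos)
  have pos: "1 + (norm x)\<^sup>2 > 0" for x :: 'a by (simp add: add_pos_nonneg)
  let ?h = "\<lambda>(x::'a) t. ennreal (indicator {0..} t * t powr (a - 1) * exp (- ((1 + (norm x)\<^sup>2) * t)))"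
  \<comment> \<open>\<open>(1 + r\<^sup>2)\<^bsup>-a\<^esup>\<close> is a mixture of Gaussians, with Gamma distributed precision \<open>t\<close>.\<close>
  have "ennreal (Gamma a) * (\<integral>\<^sup>+(x::'a). ennreal ((1 + (norm x)\<^sup>2) powr (- a)) \<partial>lborel) =
      (\<integral>\<^sup>+x. (\<integral>\<^sup>+t. ?h x t \<partial>lborel) \<partial>lborel)"
    using Ga by (simp only: nn_integral_Gamma_scaled[OF a0 pos])
      (simp add: ennreal_mult' nn_integral_cmult)
  also have "\<dots> = (\<integral>\<^sup>+t. (\<integral>\<^sup>+x. ?h x t \<partial>lborel) \<partial>lborel)"
    by (rule lborel_pair.Fubini'[symmetric]) measurable
  also have "\<dots> = (\<integral>\<^sup>+t. ennreal (pi powr (n / 2)) *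
      ennreal (indicator {0..} t * t powr ((a - n / 2) - 1) * exp (- (1 * t))) \<partial>lborel)"
  \<comment> \<open>Dropping the null point \<open>t = 0\<close> leaves \<open>t > 0\<close>, where
    the inner integral is Gaussian, and \<open>t < 0\<close>, where the indicator vanishes.\<close>
  proof (intro nn_integral_cong_AE eventually_mono[OF AE_lborel_singleton[of 0]])
    fix t :: real
    assume "t \<noteq> 0"
    show "(\<integral>\<^sup>+x. ?h x t \<partial>lborel) = ennreal (pi powr (n / 2)) *
      ennreal (indicator {0..} t * t powr ((a - n / 2) - 1) * exp (- (1 * t)))"
    proof (cases "t > 0")
      case True
      have "(\<integral>\<^sup>+x. ?h x t \<partial>lborel) = (\<integral>\<^sup>+(x::'a). ennreal (t powr (a - 1) * exp (- t)) *
          ennreal (exp (- (t * (norm x)\<^sup>2))) \<partial>lborel)"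
        using True by (intro nn_integral_cong) (simp add: algebra_simps exp_add[symmetric] flip: ennreal_mult')
      also have "\<dots> = ennreal (t powr (a - 1) * exp (- t)) * ennreal ((pi / t) powr (n / 2))"
        by (subst nn_integral_cmult) (simp_all add: nn_integral_gaussian[OF True] n_def)
      also have "\<dots> = ennreal (pi powr (n / 2)) * ennreal (t powr ((a - n / 2) - 1) * exp (- t))"
      proof -
        have "t powr (a - 1) * (pi / t) powr (n / 2) =
            pi powr (n / 2) * (t powr (a - 1) / t powr (n / 2))"
          using True by (simp add: powr_divide)
        also have "t powr (a - 1) / t powr (n / 2) = t powr ((a - n / 2) - 1)"
          by (simp add: powr_diff[symmetric] algebra_simps)
        finally show ?thesis by (simp add: mult_ac flip: ennreal_mult')
      qed
      finally show ?thesis using True by simp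
    next
      case False
      then show ?thesis using \<open>t \<noteq> 0\<close> by simp
    qed
  qed
  \<comment> \<open>The hypothesis on \<open>a\<close> makes \<open>a - n / 2\<close> positive, as
    the Gamma integral requires.\<close>
  also have "\<dots> = ennreal (pi powr (n / 2)) * ennreal (Gamma (a - n / 2) * 1 powr (- (a - n / 2)))"
    using n by (subst nn_integral_cmult, measurable) (subst nn_integral_Gamma_scaled, auto)
  also have "\<dots> = ennreal (Gamma a) * ennreal (pi powr (n / 2) * Gamma (a - n / 2) / Gamma a)"
    using n less_imp_neq[OF Ga] by (simp flip: ennreal_mult')
  finally show ?thesis
    using Ga by (simp add: ennreal_mult_cancel_left n_def)
qed

section \<open>Symmetries and second moments of the Student weight\<close>

lemma integral_lborel_orthogonal:
  fixes f :: "real^'n \<Rightarrow> 'b::{banach, second_countable_topology}"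
    and T :: "real^'n \<Rightarrow> real^'n"
  assumes f: "f \<in> borel_measurable borel" and T: "orthogonal_transformation T"
  shows "(\<integral>x. f (T x) \<partial>lborel) = integral\<^sup>L lborel f"
proof -
  have "orthogonal_matrix (matrix T)" and lin: "linear T"
    using T by (auto simp: orthogonal_transformation_matrix)
  then have "\<bar>det (matrix T)\<bar> = 1" using det_orthogonal_matrix by fastforce
  then show ?thesis
    using integral_lborel_linear[OF f, of "matrix T"] lin by (simp add: matrix_works)
qed

text \<open>Two kinds of \<open>v\<close> are used below: an axis, which flips one coordinate, and a
  difference of two axes, which swaps two. At \<open>v = 0\<close> this is the identity, so
  orthogonality holds for every \<open>v\<close>.\<close>

definition reflection :: "'a::real_inner \<Rightarrow> 'a \<Rightarrow> 'a" where
  "reflection v x = x - (2 * (x \<bullet> v) / (v \<bullet> v)) *\<^sub>R v"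

lemma orthogonal_transformation_reflection: "orthogonal_transformation (reflection v)"
  unfolding orthogonal_transformation_def
proof (intro conjI allI)
  show "linear (reflection v)"
    by (rule linearI)
      (simp_all add: reflection_def inner_add_left algebra_simps add_divide_distrib)
  show "reflection v x \<bullet> reflection v y = x \<bullet> y" for x y
    by (cases "v = 0")
      (simp_all add: reflection_def inner_diff_left inner_diff_right inner_commute algebra_simps)
qed

lemma powr_minus_add_one_mult:
  fixes s a :: real
  assumes "0 \<le> s"
  shows "(1 + s) powr (- (a + 1)) * (1 + s) = (1 + s) powr (- a)"
  using assms powr_mult_base[of "1 + s" "- (a + 1)"] by (simp add: mult.commute)

lemma
  fixes a :: real
  assumes a: "a > DIM('a::euclidean_space) / 2"
  shows integrable_student: "integrable lborel (\<lambda>x::'a. (1 + (norm x)\<^sup>2) powr (- a))"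
    and integral_student: "(\<integral>(x::'a). (1 + (norm x)\<^sup>2) powr (- a) \<partial>lborel) =
      pi powr (DIM('a) / 2) * Gamma (a - DIM('a) / 2) / Gamma a"
proof -
  have "a > 0" by (rule le_less_trans[OF _ a]) simp
  then have "Gamma (a - DIM('a) / 2) \<ge> 0" "Gamma a \<ge> 0"
    using a by (auto intro!: Gamma_real_nonneg)
  \<comment> \<open>\<open>ennreal\<close> sends negative reals to \<open>0\<close>, so the real
    value can be recovered only once its sign is known.\<close>
  then have nonneg: "pi powr (DIM('a) / 2) * Gamma (a - DIM('a) / 2) / Gamma a \<ge> 0"
    by (intro divide_nonneg_nonneg mult_nonneg_nonneg) auto
  show "integrable lborel (\<lambda>x::'a. (1 + (norm x)\<^sup>2) powr (- a))"
    by (rule integrableI_nn_integral_finite[OF _ _ nn_integral_student[OF a]]) auto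
  show "(\<integral>(x::'a). (1 + (norm x)\<^sup>2) powr (- a) \<partial>lborel) =
      pi powr (DIM('a) / 2) * Gamma (a - DIM('a) / 2) / Gamma a"
    using nonneg by (subst integral_eq_nn_integral) (auto simp: nn_integral_student[OF a])
qed

text \<open>The weight depends on the norm alone, so sign flips kill the mixed moments and
  coordinate swaps equate the diagonal ones. Their common value follows from the trace, since
  \<open>W y * (norm y)\<^sup>2\<close> is the Student function of exponent \<open>a\<close> minus
  \<open>W y\<close>.\<close>

lemma
  fixes a :: real and i j :: "'n::finite"
  assumes a: "a > CARD('n) / 2"
  defines "W \<equiv> \<lambda>y::real^'n. (1 + (norm y)\<^sup>2) powr (- (a + 1))"
  shows integrable_student_moment: "integrable lborel (\<lambda>y. W y * (y $ i * y $ j))"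
    and integral_student_moment: "(\<integral>y. W y * (y $ i * y $ j) \<partial>lborel) =
      (if i = j then integral\<^sup>L lborel W / (2 * a - CARD('n)) else 0)"
proof -
  define n where "n = real CARD('n)"
  have n: "n > 0" "a > n / 2" using a by (simp_all add: n_def)
  have a': "a > DIM(real^'n) / 2" "a + 1 > DIM(real^'n) / 2" using a by simp_all
  have [measurable]: "(\<lambda>y::real^'n. y $ k) \<in> borel_measurable borel" for k
    by (intro borel_measurable_continuous_onI continuous_intros)
  have [measurable]: "W \<in> borel_measurable borel" unfolding W_def by measurable
  have W_mult: "W y * (1 + (norm y)\<^sup>2) = (1 + (norm y)\<^sup>2) powr (- a)" for y
    unfolding W_def by (rule powr_minus_add_one_mult) simp
  have W_nonneg: "W y \<ge> 0" for y by (simp add: W_def)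
  \<comment> \<open>The quadratic factor lowers the exponent from \<open>a + 1\<close> to
    \<open>a\<close>, which still exceeds half the dimension.\<close>
  have int: "integrable lborel (\<lambda>y. W y * (y $ k * y $ l))" for k l
  proof (rule Bochner_Integration.integrable_bound[OF integrable_student[OF a'(1)]])
    have "\<bar>W y * (y $ k * y $ l)\<bar> \<le> (1 + (norm y)\<^sup>2) powr (- a)" for y
    proof -
      have "\<bar>y $ k * y $ l\<bar> \<le> norm y * norm y"
        unfolding abs_mult by (intro mult_mono component_le_norm_cart) auto
      then have "W y * \<bar>y $ k * y $ l\<bar> \<le> W y * (1 + (norm y)\<^sup>2)"
        by (intro mult_left_mono W_nonneg) (simp add: power2_eq_square)
      then show ?thesis by (simp add: abs_mult W_nonneg W_mult)
    qed
    then show "AE y in lborel. norm (W y * (y $ k * y $ l)) \<le> norm ((1 + (norm y)\<^sup>2) powr (- a))"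
      by simp
  qed measurable
  show "integrable lborel (\<lambda>y. W y * (y $ i * y $ j))" by (rule int)
  have ax: "axis k (1::real) $ l = (if l = k then 1 else 0)" for k l :: 'n
    by (simp add: axis_def)
  have intW: "integrable lborel W"
    unfolding W_def by (rule integrable_student[OF a'(2)])
  have reflect: "(\<integral>y. W y * (reflection v y $ k * reflection v y $ l) \<partial>lborel) =
      (\<integral>y. W y * (y $ k * y $ l) \<partial>lborel)" for k l and v :: "real^'n"
  proof -
    have W: "W (reflection v y) = W y" for y
      using orthogonal_transformation_reflection[of v]
      by (simp add: W_def orthogonal_transformation)
    show ?thesis
      using integral_lborel_orthogonal[OF _ orthogonal_transformation_reflection,
          of "\<lambda>y. W y * (y $ k * y $ l)" v] by (simp add: W)
  qed
  have eq: "(\<integral>y. W y * (y $ k * y $ k) \<partial>lborel) = (\<integral>y. W y * (y $ l * y $ l) \<partial>lborel)" for k l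
  proof (cases "k = l")
    case False
    have "reflection (axis k 1 - axis l 1) y $ k = y $ l" for y :: "real^'n"
      using False by (simp add: reflection_def inner_diff_left inner_diff_right
          inner_axis_axis inner_axis ax) (simp add: field_simps)
    then show ?thesis
      using reflect[of "axis k 1 - axis l 1" k k] by simp
  qed simp
  show "(\<integral>y. W y * (y $ i * y $ j) \<partial>lborel) =
      (if i = j then integral\<^sup>L lborel W / (2 * a - CARD('n)) else 0)"
  proof (cases "i = j")
    case False
    have "reflection (axis i 1) y $ i = - y $ i" "reflection (axis i 1) y $ j = y $ j" for y :: "real^'n"
      using False by (simp_all add: reflection_def inner_axis_axis inner_axis ax)
    then show ?thesis
      using reflect[of "axis i 1" i j] False by simp
  next
    case True
    have "n * (\<integral>y. W y * (y $ i * y $ i) \<partial>lborel) = (\<Sum>k::'n\<in>UNIV. \<integral>y. W y * (y $ i * y $ i) \<partial>lborel)"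
      by (simp add: n_def)
    also have "\<dots> = (\<Sum>k\<in>UNIV. \<integral>y. W y * (y $ k * y $ k) \<partial>lborel)"
      by (intro sum.cong refl eq)
    also have "\<dots> = (\<integral>y. (\<Sum>k\<in>UNIV. W y * (y $ k * y $ k)) \<partial>lborel)"
      using int by (simp add: Bochner_Integration.integral_sum)
    also have "(\<lambda>y. \<Sum>k\<in>UNIV. W y * (y $ k * y $ k)) = (\<lambda>y. (1 + (norm y)\<^sup>2) powr (- a) - W y)"
    proof
      fix y :: "real^'n"
      have "(\<Sum>k\<in>UNIV. W y * (y $ k * y $ k)) = W y * (norm y)\<^sup>2"
        by (simp add: power2_norm_eq_inner inner_vec_def sum_distrib_left)
      also have "\<dots> = W y * (1 + (norm y)\<^sup>2) - W y" by (simp add: algebra_simps)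
      finally show "(\<Sum>k\<in>UNIV. W y * (y $ k * y $ k)) = (1 + (norm y)\<^sup>2) powr (- a) - W y"
        by (simp only: W_mult)
    qed
    also have "(\<integral>y. (1 + (norm y)\<^sup>2) powr (- a) - W y \<partial>lborel) =
        (\<integral>(y::real^'n). (1 + (norm y)\<^sup>2) powr (- a) \<partial>lborel) - integral\<^sup>L lborel W"
      by (intro Bochner_Integration.integral_diff integrable_student[OF a'(1)] intW)
    \<comment> \<open>The Gamma recurrence, in numerator and denominator, gives the ratio of the
      integrals with exponents \<open>a\<close> and \<open>a + 1\<close>.\<close>
    also have "(\<integral>(y::real^'n). (1 + (norm y)\<^sup>2) powr (- a) \<partial>lborel) = integral\<^sup>L lborel W * (a / (a - n / 2))"
    proof -
      have Gamma_Suc: "Gamma (s + 1) = s * Gamma s" if "s > 0" for s :: real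
        using that nonpos_Ints_nonpos[of s] by (intro Gamma_plus1) auto
      have "a > 0" using n by linarith
      then have "Gamma (a + 1) = a * Gamma a" "Gamma (a + 1 - n / 2) = (a - n / 2) * Gamma (a - n / 2)"
        using n Gamma_Suc[of a] Gamma_Suc[of "a - n / 2"] by (simp_all add: algebra_simps)
      then show ?thesis
        unfolding W_def integral_student[OF a'(1)] integral_student[OF a'(2)]
        using n \<open>a > 0\<close> by (simp add: n_def[symmetric])
    qed
    finally have "n * (\<integral>y. W y * (y $ i * y $ i) \<partial>lborel) = n * (integral\<^sup>L lborel W / (2 * a - n))"
      using n by (simp add: field_simps)
    then have "(\<integral>y. W y * (y $ i * y $ i) \<partial>lborel) = integral\<^sup>L lborel W / (2 * a - n)"
      unfolding mult_cancel_left using n by simp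
    then show ?thesis using True by (simp add: n_def)
  qed
qed

section \<open>Feasibility and optimality of the Tsallis density\<close>

lemma matrix_inv_mult:
  fixes M :: "real^'n^'n"
  assumes "invertible M"
  shows "M ** matrix_inv M = mat 1" "matrix_inv M ** M = mat 1"
proof -
  have "M ** matrix_inv M = mat 1 \<and> matrix_inv M ** M = mat 1"
    using assms unfolding invertible_def matrix_inv_def by (rule someI_ex)
  then show "M ** matrix_inv M = mat 1" "matrix_inv M ** M = mat 1" by auto
qed

lemma det_scaleR_matrix: "det (c *\<^sub>R M) = c ^ CARD('n) * det M" for M :: "real^'n^'n"
proof -
  have "c *\<^sub>R M = matrix ((*\<^sub>R) c) ** M"
    by (simp add: matrix_eq matrix_vector_mul_assoc[symmetric] scaleR_matrix_vector_assoc matrix_works)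
  then show ?thesis by (simp add: det_mul)
qed

lemma transpose_scaleR: "transpose (c *\<^sub>R M) = c *\<^sub>R transpose M" for M :: "real^'n^'m"
  by (simp add: transpose_def vec_eq_iff)

lemma pos_definite_scaleR: "pos_definite M \<Longrightarrow> 0 < c \<Longrightarrow> pos_definite (c *\<^sub>R M)"
  by (simp add: pos_definite_def scaleR_matrix_vector_assoc[symmetric])

text \<open>The norm of nested vectors is the Frobenius norm, and the rows are multiples of
  \<open>x\<close>. This bounds the second moment integrand.\<close>

lemma norm_outer_self: "norm (outer_self x) = (norm x)\<^sup>2"
proof -
  have row: "outer_self x $ i = x $ i *\<^sub>R x" for i
    by (simp add: outer_self_def vec_eq_iff)
  show ?thesis
    unfolding norm_vec_def[of "outer_self x"] row
    by (simp add: power2_eq_square norm_vec_def[of x] flip: L2_set_left_distrib)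
qed

lemma continuous_on_outer_self: "continuous_on UNIV outer_self"
  unfolding outer_self_def[abs_def] by (intro continuous_intros)

section \<open>The Tsallis density in standard coordinates\<close>

text \<open>In the coordinates \<open>x = A *v y\<close> the quadratic form becomes
  \<open>m * (norm y)\<^sup>2\<close> with \<open>m = 2 * a - n\<close>, cancelling the coefficient
  in the density. The Gamma prefactor turns out to be the reciprocal of
  \<open>\<bar>det A\<bar>\<close> times the Student integral, so the normalization is
  visible.\<close>

lemma tsallis_density_standardize:
  fixes \<Sigma> :: "real^'n^'n" and q :: real
  assumes sym: "transpose \<Sigma> = \<Sigma>" and pos: "pos_definite \<Sigma>"
    and q: "1 < q" "q < 1 + 2 / real CARD('n)"
  defines "a \<equiv> 1 / (q - 1)"
  obtains A :: "real^'n^'n" where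
    "det A \<noteq> 0"
    "(2 * a - CARD('n)) *\<^sub>R \<Sigma> = A ** transpose A"
    "\<And>y. tsallis_density q \<Sigma> (A *v y) = (1 + (norm y)\<^sup>2) powr (- a) /
      (\<bar>det A\<bar> * (\<integral>(y::real^'n). (1 + (norm y)\<^sup>2) powr (- a) \<partial>lborel))"
proof -
  define n where "n = real CARD('n)"
  define m where "m = 2 * a - n"
  have n: "n > 0" by (simp add: n_def)
  \<comment> \<open>The upper bound on \<open>q\<close> enters as \<open>m > 0\<close>, that is
    \<open>a > n / 2\<close>, the convergence condition of the Student integral.\<close>
  have "(q - 1) * n < 2" using q n by (simp add: n_def[symmetric] field_simps)
  then have m: "m > 0" using q by (simp add: m_def a_def field_simps)
  have a: "a > n / 2" using m by (simp add: m_def)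
  then have a': "a > DIM(real^'n) / 2" by (simp add: n_def)
  obtain A :: "real^'n^'n" where A: "m *\<^sub>R \<Sigma> = A ** transpose A" and inv: "invertible A"
    using pos_definite_factorization[OF _ pos_definite_scaleR[OF pos m]]
    by (metis transpose_scaleR sym)
  have detA: "det A \<noteq> 0" using inv by (simp add: invertible_det_nz)
  have det: "m ^ CARD('n) * det \<Sigma> = (det A)\<^sup>2"
    using arg_cong[OF A, of det] by (simp add: det_scaleR_matrix det_mul power2_eq_square)
  have inv\<Sigma>: "invertible \<Sigma>"
    using det detA by (auto simp: invertible_det_nz)
  \<comment> \<open>For \<open>z = matrix_inv \<Sigma> *v (A *v y)\<close> the factorization gives
    \<open>A *v (transpose A *v z) = A *v (m *\<^sub>R y)\<close>, and \<open>A\<close> is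
    injective.\<close>
  have quad: "(A *v y) \<bullet> (matrix_inv \<Sigma> *v (A *v y)) = m * (norm y)\<^sup>2" for y
  proof -
    define z where "z = matrix_inv \<Sigma> *v (A *v y)"
    have "A *v (transpose A *v z) = (A ** transpose A) *v z"
      by (rule matrix_vector_mul_assoc)
    also have "\<dots> = m *\<^sub>R (\<Sigma> *v z)"
      unfolding A[symmetric] by (rule scaleR_matrix_vector_assoc[symmetric])
    also have "\<Sigma> *v z = A *v y"
      unfolding z_def matrix_vector_mul_assoc[of \<Sigma>] by (simp add: matrix_inv_mult[OF inv\<Sigma>])
    also have "m *\<^sub>R (A *v y) = A *v (m *\<^sub>R y)" by (simp add: matrix_vector_mult_scaleR)
    finally have "transpose A *v z = m *\<^sub>R y"
      using inj_matrix_vector_mult[OF inv] by (simp add: inj_def)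
    moreover have "(A *v y) \<bullet> z = y \<bullet> (transpose A *v z)"
      by (metis dot_lmul_matrix vector_transpose_matrix transpose_transpose)
    ultimately show ?thesis by (simp add: z_def power2_norm_eq_inner)
  qed
  \<comment> \<open>This is the determinant of the factorization; the power of \<open>m\<close> will
    cancel the same power in the density.\<close>
  have sqrt_det: "sqrt (det (pi *\<^sub>R \<Sigma>)) = pi powr (n / 2) * \<bar>det A\<bar> * m powr (- (n / 2))"
  proof (rule real_sqrt_unique)
    have p: "(c powr (n / 2))\<^sup>2 = c ^ CARD('n)" if "c > 0" for c :: real
      using that by (simp add: power2_eq_square n_def powr_realpow flip: powr_add)
    have "(m powr (- (n / 2)))\<^sup>2 = 1 / m ^ CARD('n)"
      using m by (simp add: powr_minus power_inverse p divide_simps)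
    then show "(pi powr (n / 2) * \<bar>det A\<bar> * m powr (- (n / 2)))\<^sup>2 = det (pi *\<^sub>R \<Sigma>)"
      using m by (simp add: power_mult_distrib p det_scaleR_matrix flip: det)
  qed simp
  have "tsallis_density q \<Sigma> (A *v y) = (1 + (norm y)\<^sup>2) powr (- a) /
      (\<bar>det A\<bar> * (\<integral>(y::real^'n). (1 + (norm y)\<^sup>2) powr (- a) \<partial>lborel))" for y
  proof -
    have im: "inverse m * (m * c) = c" for c using m by simp
    have e: "1 / (1 - q) = - a" using q by (simp add: a_def field_simps)
    have m2: "2 / (q - 1) - n = m" by (simp add: m_def a_def)
    have "tsallis_density q \<Sigma> (A *v y) = 1 / (pi powr (n / 2) * \<bar>det A\<bar> * m powr (- (n / 2)))
        * (Gamma a / Gamma (a - n / 2)) * m powr (- (n / 2)) * (1 + (norm y)\<^sup>2) powr (- a)"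
      using m unfolding tsallis_density_def
      by (simp add: n_def[symmetric] m2 e quad sqrt_det im flip: a_def)
    then show ?thesis
      unfolding integral_student[OF a'] using less_imp_neq[OF m] by (simp add: n_def mult_ac)
  qed
  then show ?thesis
    by (rule that[OF detA A[unfolded m_def n_def]])
qed

text \<open>Read off from the standardized form: the Gamma arguments \<open>a\<close> and
  \<open>a - n / 2\<close> are positive, and invertibility of \<open>A\<close> makes every
  \<open>x\<close> some \<open>A *v y\<close>.\<close>

lemma tsallis_density_pos:
  fixes \<Sigma> :: "real^'n^'n"
  assumes sym: "transpose \<Sigma> = \<Sigma>" and pos: "pos_definite \<Sigma>"
    and q: "1 < q" "q < 1 + 2 / real CARD('n)"
  shows "tsallis_density q \<Sigma> x > 0"
proof -
  define a where "a = 1 / (q - 1)"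
  define I where "I = (\<integral>(y::real^'n). (1 + (norm y)\<^sup>2) powr (- a) \<partial>lborel)"
  obtain A :: "real^'n^'n" where A: "det A \<noteq> 0"
    and p: "\<And>y. tsallis_density q \<Sigma> (A *v y) = (1 + (norm y)\<^sup>2) powr (- a) / (\<bar>det A\<bar> * I)"
    using tsallis_density_standardize[OF assms] unfolding a_def I_def by metis
  have "a > real CARD('n) / 2"
    using q by (simp add: a_def field_simps)
  then have a: "a > DIM(real^'n) / 2" by simp
  then have "a > 0" by (rule le_less_trans[rotated]) simp
  have "I > 0"
    unfolding I_def integral_student[OF a]
    using a \<open>a > 0\<close> by (intro divide_pos_pos mult_pos_pos Gamma_real_pos) auto
  have "A *v (matrix_inv A *v x) = x"
    using A by (simp add: matrix_vector_mul_assoc matrix_inv_mult invertible_det_nz)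
  then have eq: "tsallis_density q \<Sigma> x =
      (1 + (norm (matrix_inv A *v x))\<^sup>2) powr (- a) / (\<bar>det A\<bar> * I)"
    using p[of "matrix_inv A *v x"] by (simp only:)
  have "1 + (norm (matrix_inv A *v x))\<^sup>2 > 0"
    by (intro add_pos_nonneg) auto
  then have "(1 + (norm (matrix_inv A *v x))\<^sup>2) powr (- a) / (\<bar>det A\<bar> * I) > 0"
    using A \<open>I > 0\<close> by (intro divide_pos_pos mult_pos_pos) auto
  then show ?thesis by (simp only: eq)
qed

lemma borel_measurable_tsallis_density [measurable]: "tsallis_density q \<Sigma> \<in> borel_measurable borel"
proof -
  have [measurable]: "(\<lambda>x. matrix_inv \<Sigma> *v x) \<in> borel \<rightarrow>\<^sub>M borel"
    by (intro borel_measurable_continuous_onI continuous_intros)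
  show ?thesis unfolding tsallis_density_def[abs_def] by measurable
qed

text \<open>Each integral is moved to standard coordinates, where \<open>p\<close> and
  \<open>p powr q\<close> are multiples of the Student functions of exponents \<open>a\<close> and
  \<open>a + 1\<close>.\<close>

lemma feasible_tsallis_density:
  fixes \<Sigma> :: "real^'n^'n"
  assumes sym: "transpose \<Sigma> = \<Sigma>" and pos: "pos_definite \<Sigma>"
    and q: "1 < q" "q < 1 + 2 / real CARD('n)"
  shows "feasible q \<Sigma> (tsallis_density q \<Sigma>)"
proof -
  define p where "p = tsallis_density q \<Sigma>"
  define a where "a = 1 / (q - 1)"
  define I where "I = (\<integral>(y::real^'n). (1 + (norm y)\<^sup>2) powr (- a) \<partial>lborel)"
  define W where "W y = (1 + (norm y)\<^sup>2) powr (- (a + 1))" for y :: "real^'n"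
  obtain A :: "real^'n^'n" where A: "det A \<noteq> 0"
    and AA: "(2 * a - CARD('n)) *\<^sub>R \<Sigma> = A ** transpose A"
    and p: "\<And>y. p (A *v y) = (1 + (norm y)\<^sup>2) powr (- a) / (\<bar>det A\<bar> * I)"
    using tsallis_density_standardize[OF assms] unfolding a_def I_def p_def by metis
  have a: "a > real CARD('n) / 2"
    using q by (simp add: a_def field_simps)
  then have a': "a > DIM(real^'n) / 2" "a + 1 > DIM(real^'n) / 2" by simp_all
  have p_pos: "p x > 0" for x
    unfolding p_def using assms by (rule tsallis_density_pos)
  have I: "I > 0"
  proof -
    have "I \<ge> 0" unfolding I_def by (intro Bochner_Integration.integral_nonneg) auto
    \<comment> \<open>Otherwise division by zero would make \<open>p\<close> vanish, against its
      positivity.\<close>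
    moreover have "I \<noteq> 0" using p_pos[of "A *v 0"] unfolding p by auto
    ultimately show ?thesis by linarith
  qed
  have [measurable]: "p \<in> borel_measurable borel" unfolding p_def by measurable
  have [measurable]: "(\<lambda>y::real^'n. A *v y) \<in> borel \<rightarrow>\<^sub>M borel"
    by (intro borel_measurable_continuous_onI continuous_intros)
  have [measurable]: "(\<lambda>y::real^'n. y $ k) \<in> borel_measurable borel" for k
    by (intro borel_measurable_continuous_onI continuous_intros)
  have [measurable]: "outer_self \<in> borel_measurable (borel :: (real^'n) measure)"
    by (rule borel_measurable_continuous_onI[OF continuous_on_outer_self])
  have [measurable]: "W \<in> borel_measurable borel" unfolding W_def[abs_def] by measurable
  define C where "C = (1 / (\<bar>det A\<bar> * I)) powr q"
  have C: "C > 0" using A I by (simp add: C_def)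
  have pq: "p (A *v y) powr q = C * W y" for y
  proof -
    have "p (A *v y) powr q = C * ((1 + (norm y)\<^sup>2) powr (- a)) powr q"
      using I by (simp add: p C_def powr_mult powr_divide)
    \<comment> \<open>This follows from \<open>a * (q - 1) = 1\<close> and is why the second moments
      were computed for the exponent \<open>a + 1\<close>.\<close>
    also have "- a * q = - (a + 1)"
      using q by (simp add: a_def field_simps)
    then have "((1 + (norm y)\<^sup>2) powr (- a)) powr q = W y"
      by (simp add: powr_powr W_def)
    finally show ?thesis .
  qed
  have W_nonneg: "W y \<ge> 0" for y by (simp add: W_def)
  have intW: "integrable lborel W"
    unfolding W_def[abs_def] by (rule integrable_student[OF a'(2)])
  have int_p: "integrable lborel p"
    unfolding integrable_lborel_linear_iff[OF \<open>p \<in> _\<close> A] p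
    by (intro integrable_divide_zero integrable_student[OF a'(1)])
  have p_1: "integral\<^sup>L lborel p = 1"
    using I A unfolding integral_lborel_linear[OF \<open>p \<in> _\<close> A] p
    by (simp flip: I_def)
  have int_pq: "integrable lborel (\<lambda>x. p x powr q)"
    by (subst integrable_lborel_linear_iff[OF _ A]) (simp_all add: pq intW)
  define N where "N = (\<integral>x. p x powr q \<partial>lborel)"
  have N_eq: "N = \<bar>det A\<bar> * C * integral\<^sup>L lborel W"
    unfolding N_def by (subst integral_lborel_linear[OF _ A]) (simp_all add: pq)
  \<comment> \<open>A zero integral would force \<open>p powr q = 0\<close> almost everywhere,
    impossible for positive \<open>p\<close> since Lebesgue measure is not null.\<close>
  have N: "N \<noteq> 0"
  proof
    assume "N = 0"
    then have "AE x in lborel. p x powr q = 0"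
      unfolding N_def by (subst (asm) integral_nonneg_eq_0_iff_AE[OF int_pq]) auto
    moreover have "p x \<noteq> 0" for x using p_pos[of x] by simp
    ultimately have "AE x in lborel :: (real^'n) measure. False" by simp
    then show False
      using ae_filter_eq_bot_iff[of "lborel :: (real^'n) measure"] by (simp add: trivial_limit_def)
  qed
  obtain K where K: "\<And>y. norm (A *v y) \<le> K * norm y" "K > 0"
    using bounded_linear.pos_bounded[OF matrix_vector_mul_bounded_linear[of A]]
    by (metis mult.commute)
  have W_mult: "W y * (1 + (norm y)\<^sup>2) = (1 + (norm y)\<^sup>2) powr (- a)" for y
    unfolding W_def by (rule powr_minus_add_one_mult) simp
  \<comment> \<open>The integrand is dominated by a Student function of exponent \<open>a\<close>,
    because \<open>norm y \<le> 1 + (norm y)\<^sup>2\<close>.\<close>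
  have int_mean: "integrable lborel (\<lambda>x. p x powr q *\<^sub>R x)"
  proof (subst integrable_lborel_linear_iff[OF _ A])
    show "integrable lborel (\<lambda>y. p (A *v y) powr q *\<^sub>R (A *v y))"
    proof (rule Bochner_Integration.integrable_bound[where
          f="\<lambda>y::real^'n. C * K * (1 + (norm y)\<^sup>2) powr (- a)"])
      show "integrable lborel (\<lambda>y::real^'n. C * K * (1 + (norm y)\<^sup>2) powr (- a))"
        by (intro integrable_mult_right integrable_student[OF a'(1)])
      have "norm (p (A *v y) powr q *\<^sub>R (A *v y)) \<le> norm (C * K * (1 + (norm y)\<^sup>2) powr (- a))" for y
      proof -
        have "norm y \<le> 1 + (norm y)\<^sup>2"
          using zero_le_power2[of "norm y - 1"] norm_ge_zero[of y] by (simp add: power2_eq_square algebra_simps del: norm_ge_zero)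
        then have "norm (A *v y) \<le> K * (1 + (norm y)\<^sup>2)"
          using K by (meson mult_left_mono order.trans less_imp_le)
        then have "C * W y * norm (A *v y) \<le> C * W y * (K * (1 + (norm y)\<^sup>2))"
          using C W_nonneg[of y] by (intro mult_left_mono) auto
        also have "\<dots> = C * K * (1 + (norm y)\<^sup>2) powr (- a)"
          by (simp flip: W_mult)
        finally show ?thesis using C K W_nonneg[of y] by (simp add: pq)
      qed
      then show "AE y in lborel. norm (p (A *v y) powr q *\<^sub>R (A *v y)) \<le>
          norm (C * K * (1 + (norm y)\<^sup>2) powr (- a))"
        by simp
    qed measurable
  qed measurable
  \<comment> \<open>The density is even, so this integral equals its own negative.\<close>
  have mean: "(\<integral>x. p x powr q *\<^sub>R x \<partial>lborel) = 0"
  proof -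
    have "p (- x) = p x" for x
    proof -
      have "A *v (matrix_inv A *v x) = x"
        using A by (simp add: matrix_vector_mul_assoc matrix_inv_mult invertible_det_nz)
      then obtain y where y: "x = A *v y" by metis
      have "- x = A *v (- y)"
        by (simp add: y matrix_vector_mult_scaleR[of A "-1", simplified])
      then show ?thesis unfolding y by (simp add: p)
    qed
    moreover have "orthogonal_transformation (uminus :: real^'n \<Rightarrow> real^'n)"
      by (simp add: orthogonal_transformation_neg[of "\<lambda>x. x"])
    from integral_lborel_orthogonal[OF _ this, of "\<lambda>x. p x powr q *\<^sub>R x"]
    have "(\<integral>x. p (- x) powr q *\<^sub>R (- x) \<partial>lborel) = (\<integral>x. p x powr q *\<^sub>R x \<partial>lborel)" by simp
    ultimately have "- (\<integral>x. p x powr q *\<^sub>R x \<partial>lborel) = (\<integral>x. p x powr q *\<^sub>R x \<partial>lborel)" by simp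
    moreover have "v = 0" if "- v = v" for v :: "real^'n"
      using that by (simp add: vec_eq_iff)
    ultimately show ?thesis by blast
  qed
  have int_outer: "integrable lborel (\<lambda>x. p x powr q *\<^sub>R outer_self x)"
  proof (subst integrable_lborel_linear_iff[OF _ A])
    show "integrable lborel (\<lambda>y. p (A *v y) powr q *\<^sub>R outer_self (A *v y))"
    proof (rule Bochner_Integration.integrable_bound[where
          f="\<lambda>y::real^'n. C * K\<^sup>2 * (1 + (norm y)\<^sup>2) powr (- a)"])
      show "integrable lborel (\<lambda>y::real^'n. C * K\<^sup>2 * (1 + (norm y)\<^sup>2) powr (- a))"
        by (intro integrable_mult_right integrable_student[OF a'(1)])
      have "norm (p (A *v y) powr q *\<^sub>R outer_self (A *v y)) \<le>
          norm (C * K\<^sup>2 * (1 + (norm y)\<^sup>2) powr (- a))" for y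
      proof -
        have "(norm (A *v y))\<^sup>2 \<le> (K * norm y)\<^sup>2"
          using K by (intro power_mono) auto
        also have "\<dots> \<le> K\<^sup>2 * (1 + (norm y)\<^sup>2)"
          unfolding power_mult_distrib by (intro mult_left_mono) auto
        finally have "C * W y * (norm (A *v y))\<^sup>2 \<le> C * W y * (K\<^sup>2 * (1 + (norm y)\<^sup>2))"
          using C W_nonneg[of y] by (intro mult_left_mono) auto
        also have "\<dots> = C * K\<^sup>2 * (1 + (norm y)\<^sup>2) powr (- a)"
          by (simp flip: W_mult)
        finally show ?thesis using C K W_nonneg[of y] by (simp add: pq norm_outer_self)
      qed
      then show "AE y in lborel. norm (p (A *v y) powr q *\<^sub>R outer_self (A *v y)) \<le>
          norm (C * K\<^sup>2 * (1 + (norm y)\<^sup>2) powr (- a))"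
        by simp
    qed measurable
  qed measurable
  \<comment> \<open>Only diagonal moments survive the expansion of \<open>A *v y\<close>, leaving a
    multiple of \<open>A ** transpose A\<close>; its factor \<open>m\<close> cancels the
    \<open>m\<close> in the moments, and the remaining factor is \<open>N\<close>.\<close>
  have outer: "(\<integral>x. p x powr q *\<^sub>R outer_self x \<partial>lborel) $ i $ j = N * \<Sigma> $ i $ j" for i j
  proof -
    have lin: "bounded_linear (\<lambda>M::real^'n^'n. M $ i $ j)"
      by (intro bounded_linear_compose[OF bounded_linear_vec_nth] bounded_linear_vec_nth)
    define m where "m = 2 * a - CARD('n)"
    have m: "m > 0" using a by (simp add: m_def)
    have int_W: "integrable lborel (\<lambda>y. W y * (y $ k * y $ l))" for k l
      unfolding W_def by (rule integrable_student_moment[OF a])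
    have integral_W: "(\<integral>y. W y * (y $ k * y $ l) \<partial>lborel) = (if k = l then integral\<^sup>L lborel W / m else 0)" for k l
      unfolding W_def[abs_def] m_def by (rule integral_student_moment[OF a])
    have Ay: "(A *v y) $ i * (A *v y) $ j = (\<Sum>k\<in>UNIV. \<Sum>l\<in>UNIV. A $ i $ k * A $ j $ l * (y $ k * y $ l))" for y
      unfolding matrix_vector_mult_def vec_lambda_beta sum_product by (simp only: mult_ac)
    have "(\<integral>x. p x powr q *\<^sub>R outer_self x \<partial>lborel) $ i $ j =
        (\<integral>x. (p x powr q *\<^sub>R outer_self x) $ i $ j \<partial>lborel)"
      by (rule integral_bounded_linear[OF lin int_outer, symmetric])
    also have "\<dots> = (\<integral>x. p x powr q * (x $ i * x $ j) \<partial>lborel)"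
      by (simp add: outer_self_def)
    also have "\<dots> = \<bar>det A\<bar> * (\<integral>y. C * W y * ((A *v y) $ i * (A *v y) $ j) \<partial>lborel)"
      by (subst integral_lborel_linear[OF _ A]) (simp_all add: pq)
    also have "(\<lambda>y. C * W y * ((A *v y) $ i * (A *v y) $ j)) =
        (\<lambda>y. \<Sum>k\<in>UNIV. \<Sum>l\<in>UNIV. C * A $ i $ k * A $ j $ l * (W y * (y $ k * y $ l)))"
      unfolding Ay sum_distrib_left by (simp only: mult_ac)
    also have "(\<integral>y. \<dots> y \<partial>lborel) =
        (\<Sum>k\<in>UNIV. \<Sum>l\<in>UNIV. C * A $ i $ k * A $ j $ l * (\<integral>y. W y * (y $ k * y $ l) \<partial>lborel))"
      using int_W by (simp add: Bochner_Integration.integral_sum)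
    also have "\<dots> = (\<Sum>k\<in>UNIV. \<Sum>l\<in>UNIV. C * A $ i $ k * A $ j $ l *
        (if k = l then integral\<^sup>L lborel W / m else 0))"
      by (simp only: integral_W)
    also have "\<dots> = C * integral\<^sup>L lborel W / m * (A ** transpose A) $ i $ j"
      by (simp add: if_distrib matrix_matrix_mult_def transpose_def sum_distrib_left algebra_simps cong: if_cong)
    also have "(A ** transpose A) $ i $ j = m * \<Sigma> $ i $ j"
      by (simp add: AA[symmetric] m_def)
    finally show ?thesis using m by (simp add: N_eq)
  qed
  \<comment> \<open>The integrands are Borel measurable, so passing to the completion changes
    neither integrability nor value.\<close>
  have leb: "integrable lebesgue f \<longleftrightarrow> integrable lborel f" "integral\<^sup>L lebesgue f = integral\<^sup>L lborel f"
    if "f \<in> borel_measurable borel" for f :: "real^'n \<Rightarrow> 'b::{banach, second_countable_topology}"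
    using that by (simp_all add: integrable_completion integral_completion)
  have abs: "\<bar>p x\<bar> powr q = p x powr q" for x using p_pos[of x] by simp
  have "normalized_q_second_moment q p = \<Sigma>"
    using N outer unfolding normalized_q_second_moment_def
    by (simp add: vec_eq_iff leb N_def)
  moreover have "normalized_q_mean q p = 0"
    unfolding normalized_q_mean_def by (simp add: leb mean)
  ultimately have "feasible q \<Sigma> p"
    unfolding feasible_def Lq_def
    using p_pos int_p int_pq p_1 int_mean int_outer
    by (simp add: leb abs less_imp_le measurable_completion)
  then show ?thesis by (simp add: p_def)
qed

section \<open>Optimality and uniqueness\<close>

text \<open>One deficit function \<open>d\<close> serves both parts: it is nonnegative almost
  everywhere and integrates to the difference of the objectives. If that is zero, \<open>d\<close>
  vanishes almost everywhere, and \<open>w > 0\<close> leaves equality in the tangent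
  inequality.\<close>

lemma objective_tsallis_density_max:
  fixes \<Sigma> :: "real^'n^'n"
  assumes sym: "transpose \<Sigma> = \<Sigma>" and pos: "pos_definite \<Sigma>"
    and q: "1 < q" "q < 1 + 2 / real CARD('n)"
    and feas: "feasible q \<Sigma> \<phi>"
  shows "objective q \<phi> \<le> objective q (tsallis_density q \<Sigma>)"
    and "objective q \<phi> = objective q (tsallis_density q \<Sigma>) \<Longrightarrow>
      AE x in lebesgue. \<phi> x = tsallis_density q \<Sigma> x"
proof -
  define p where "p = tsallis_density q \<Sigma>"
  define n where "n = real CARD('n)"
  define a where "a = 1 / (q - 1)"
  define m where "m = 2 * a - n"
  define Q where "Q x = x \<bullet> (matrix_inv \<Sigma> *v x)" for x
  define w where "w x = (m + Q x) / (m + n)" for x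
  have n: "n > 0" by (simp add: n_def)
  have "(q - 1) * n < 2" using q n by (simp add: n_def[symmetric] field_simps)
  then have m: "m > 0" using q by (simp add: m_def a_def field_simps)
  have inv: "invertible \<Sigma>"
  proof -
    obtain A :: "real^'n^'n" where "\<Sigma> = A ** transpose A" "invertible A"
      using pos_definite_factorization[OF sym pos] .
    then show ?thesis by (simp add: invertible_det_nz det_mul)
  qed
  have Q_nonneg: "Q x \<ge> 0" for x
  proof -
    define z where "z = matrix_inv \<Sigma> *v x"
    have x: "x = \<Sigma> *v z"
      unfolding z_def matrix_vector_mul_assoc by (simp add: matrix_inv_mult[OF inv])
    have "z \<bullet> (\<Sigma> *v z) \<ge> 0"
      using pos by (cases "z = 0") (auto simp: pos_definite_def less_imp_le)
    also have "z \<bullet> (\<Sigma> *v z) = Q x"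
      unfolding x[symmetric] by (simp add: Q_def z_def inner_commute)
    finally show ?thesis .
  qed
  have w_pos: "w x > 0" for x
    unfolding w_def using m n Q_nonneg[of x] by (intro divide_pos_pos) auto
  have Q_sum: "Q x = (\<Sum>i\<in>UNIV. \<Sum>j\<in>UNIV. matrix_inv \<Sigma> $ i $ j * outer_self x $ i $ j)" for x
    by (simp add: Q_def inner_vec_def matrix_vector_mult_def outer_self_def sum_distrib_left mult_ac)
  \<comment> \<open>The second moment constraint gives \<open>\<integral>Q \<psi>\<^sup>q = n \<integral>\<psi>\<^sup>q\<close>, so weighting with \<open>w\<close> does not change
    the integral of \<open>\<psi>\<^sup>q\<close>.\<close>
  have weighted: "integrable lebesgue (\<lambda>x. w x * \<psi> x powr q)"
      "(\<integral>x. w x * \<psi> x powr q \<partial>lebesgue) = (\<integral>x. \<psi> x powr q \<partial>lebesgue)"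
    if \<psi>: "feasible q \<Sigma> \<psi>" for \<psi> :: "real^'n \<Rightarrow> real"
  proof -
    define N where "N = (\<integral>x. \<psi> x powr q \<partial>lebesgue)"
    define M where "M = (\<integral>x. \<psi> x powr q *\<^sub>R outer_self x \<partial>lebesgue)"
    have nonneg: "AE x in lebesgue. \<psi> x \<ge> 0" and meas: "\<psi> \<in> borel_measurable lebesgue"
      and "integrable lebesgue (\<lambda>x. \<bar>\<psi> x\<bar> powr q)"
      and int_outer: "integrable lebesgue (\<lambda>x. \<psi> x powr q *\<^sub>R outer_self x)"
      and moment: "M /\<^sub>R N = \<Sigma>"
      using \<psi> by (auto simp: feasible_def Lq_def normalized_q_second_moment_def N_def M_def)
    have "integrable lebesgue (\<lambda>x. \<psi> x powr q) \<longleftrightarrow> integrable lebesgue (\<lambda>x. \<bar>\<psi> x\<bar> powr q)"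
      using meas nonneg by (intro Bochner_Integration.integrable_cong_AE) auto
    then have int: "integrable lebesgue (\<lambda>x. \<psi> x powr q)"
      using \<open>integrable lebesgue (\<lambda>x. \<bar>\<psi> x\<bar> powr q)\<close> by simp
    \<comment> \<open>By the convention \<open>inverse 0 = 0\<close>, \<open>N = 0\<close> would
      make the normalized second moment zero, contradicting positive definiteness of
      \<open>\<Sigma>\<close>.\<close>
    have "N \<noteq> 0"
    proof
      assume "N = 0"
      then have "\<Sigma> = 0" using moment by simp
      then show False
        using pos axis_eq_0_iff[of undefined "1::real"] unfolding pos_definite_def by force
    qed
    then have M: "M = N *\<^sub>R \<Sigma>" using moment by (auto simp: field_simps)
    have lin: "bounded_linear (\<lambda>M::real^'n^'n. M $ i $ j)" for i j
      by (intro bounded_linear_compose[OF bounded_linear_vec_nth] bounded_linear_vec_nth)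
    have int_ij: "integrable lebesgue (\<lambda>x. \<psi> x powr q * outer_self x $ i $ j)" for i j
      using integrable_bounded_linear[OF lin int_outer, of i j] by simp
    have "(\<integral>x. \<psi> x powr q * outer_self x $ i $ j \<partial>lebesgue) = N * \<Sigma> $ i $ j" for i j
      using integral_bounded_linear[OF lin int_outer, of i j] M by (simp add: M_def[symmetric])
    note int_ij_eq = this
    have Q_expand: "\<psi> x powr q * Q x =
        (\<Sum>i\<in>UNIV. \<Sum>j\<in>UNIV. matrix_inv \<Sigma> $ i $ j * (\<psi> x powr q * outer_self x $ i $ j))" for x
      by (simp add: Q_sum sum_distrib_left mult.left_commute)
    have int_Q: "integrable lebesgue (\<lambda>x. \<psi> x powr q * Q x)"
      unfolding Q_expand
      by (intro Bochner_Integration.integrable_sum integrable_mult_right int_ij)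
    have "(\<integral>x. \<psi> x powr q * Q x \<partial>lebesgue) =
        (\<Sum>i\<in>UNIV. \<Sum>j\<in>UNIV. matrix_inv \<Sigma> $ i $ j * (N * \<Sigma> $ i $ j))"
      unfolding Q_expand using int_ij by (simp add: Bochner_Integration.integral_sum int_ij_eq)
    \<comment> \<open>The double sum is a trace, and symmetry of \<open>\<Sigma>\<close> makes it
      the trace of the identity.\<close>
    also have "(\<Sum>i\<in>UNIV. \<Sum>j\<in>UNIV. matrix_inv \<Sigma> $ i $ j * (N * \<Sigma> $ i $ j)) =
        N * (\<Sum>i\<in>UNIV. (matrix_inv \<Sigma> ** transpose \<Sigma>) $ i $ i)"
      by (simp add: matrix_matrix_mult_def transpose_def sum_distrib_left mult_ac)
    also have "\<dots> = N * n"
      by (simp add: sym matrix_inv_mult[OF inv] mat_def n_def)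
    finally have Q_eq: "(\<integral>x. \<psi> x powr q * Q x \<partial>lebesgue) = N * n" .
    have w: "w x * \<psi> x powr q = (m / (m + n)) * \<psi> x powr q + (1 / (m + n)) * (\<psi> x powr q * Q x)" for x
      by (simp add: w_def add_divide_distrib algebra_simps)
    show "integrable lebesgue (\<lambda>x. w x * \<psi> x powr q)"
      unfolding w using int int_Q by (intro Bochner_Integration.integrable_add integrable_mult_right)
    have "(\<integral>x. w x * \<psi> x powr q \<partial>lebesgue) = (m / (m + n)) * N + (1 / (m + n)) * (N * n)"
      unfolding w using int int_Q by (simp add: Bochner_Integration.integral_add Q_eq N_def)
    also have "\<dots> = (N * m + N * n) / (m + n)"
      by (simp add: add_divide_distrib mult.commute)
    also have "\<dots> = N" using m n by (simp flip: distrib_left)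
    finally show "(\<integral>x. w x * \<psi> x powr q \<partial>lebesgue) = (\<integral>x. \<psi> x powr q \<partial>lebesgue)"
      by (simp add: N_def)
  qed
  have feas_p: "feasible q \<Sigma> p"
    unfolding p_def using sym pos q by (rule feasible_tsallis_density)
  have p_pos: "p x > 0" for x
    unfolding p_def using sym pos q by (rule tsallis_density_pos)
  \<comment> \<open>The weights in \<open>w\<close> are those that make the tangent slope \<open>q w p\<^bsup>q-1\<^esup>\<close> constant.\<close>
  obtain \<kappa> where \<kappa>: "\<And>x. w x * p x powr (q - 1) = \<kappa>"
  proof -
    define Z where "Z = 1 / sqrt (det (pi *\<^sub>R \<Sigma>)) * (Gamma a / Gamma (a - n / 2)) * m powr (- (n / 2))"
    have p: "p x = Z * (1 + inverse m * Q x) powr (- a)" for x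
    proof -
      have "1 / (1 - q) = - a" using q by (simp add: a_def field_simps)
      moreover have "2 / (q - 1) - real CARD('n) = m" by (simp add: m_def a_def n_def)
      ultimately show ?thesis
        unfolding p_def tsallis_density_def Z_def by (simp only: Q_def a_def n_def)
    qed
    have "Z > 0"
      using p_pos[of 0] unfolding p by (simp add: zero_less_mult_iff)
    \<comment> \<open>Since \<open>a * (q - 1) = 1\<close>, \<open>p x powr (q - 1)\<close> is
      proportional to the reciprocal of \<open>1 + inverse m * Q x\<close>, and \<open>w x\<close>
      to that expression itself.\<close>
    have "w x * p x powr (q - 1) = m / (m + n) * Z powr (q - 1)" for x
    proof -
      have b: "1 + inverse m * Q x > 0"
        using m Q_nonneg[of x] by (intro add_pos_nonneg mult_nonneg_nonneg) auto
      have "p x powr (q - 1) = Z powr (q - 1) * ((1 + inverse m * Q x) powr (- a)) powr (q - 1)"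
        unfolding p using b \<open>Z > 0\<close> by (subst powr_mult) auto
      also have "((1 + inverse m * Q x) powr (- a)) powr (q - 1) = (1 + inverse m * Q x) powr (- 1)"
        using q by (simp only: powr_powr) (simp add: a_def)
      also have "\<dots> = 1 / (1 + inverse m * Q x)"
        using b by (simp add: powr_minus_divide)
      finally have "p x powr (q - 1) = Z powr (q - 1) / (1 + inverse m * Q x)" by simp
      moreover have "w x = m / (m + n) * (1 + inverse m * Q x)"
      proof -
        have "m * (1 + inverse m * Q x) = m + Q x" using m by (simp add: distrib_left)
        then show ?thesis by (simp add: w_def)
      qed
      ultimately show ?thesis using b by simp
    qed
    then show ?thesis by (rule that)
  qed
  \<comment> \<open>With the constant slope, the linear term integrates to zero because
    \<open>\<phi>\<close> and \<open>p\<close> both have integral \<open>1\<close>.\<close>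
  define d where "d x = w x * \<phi> x powr q - w x * p x powr q - q * \<kappa> * (\<phi> x - p x)" for x
  have d_eq: "d x = w x * (\<phi> x powr q - (p x powr q + q * p x powr (q - 1) * (\<phi> x - p x)))" for x
    unfolding d_def \<kappa>[of x, symmetric] by (simp add: algebra_simps)
  have feas': "integrable lebesgue \<phi>" "integrable lebesgue p" "integral\<^sup>L lebesgue \<phi> = 1"
    "integral\<^sup>L lebesgue p = 1" "AE x in lebesgue. \<phi> x \<ge> 0"
    using feas feas_p by (auto simp: feasible_def)
  have int_d: "integrable lebesgue d"
    unfolding d_def[abs_def] using weighted(1)[OF feas] weighted(1)[OF feas_p] feas'
    by (intro Bochner_Integration.integrable_diff integrable_mult_right)
  have integral_d: "integral\<^sup>L lebesgue d = objective q p - objective q \<phi>"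
    unfolding d_def[abs_def] objective_def
    using weighted[OF feas] weighted[OF feas_p] feas'
    by (simp add: Bochner_Integration.integral_diff)
  have d_nonneg: "AE x in lebesgue. 0 \<le> d x"
    using feas'(5)
  proof eventually_elim
    case (elim x)
    then show ?case
      unfolding d_eq using powr_tangent_le(1)[OF q(1) elim p_pos[of x]] w_pos[of x]
      by (intro mult_nonneg_nonneg) auto
  qed
  then have "integral\<^sup>L lebesgue d \<ge> 0" by (rule integral_nonneg_AE)
  then show "objective q \<phi> \<le> objective q (tsallis_density q \<Sigma>)"
    unfolding integral_d by (simp add: p_def)
  assume "objective q \<phi> = objective q (tsallis_density q \<Sigma>)"
  then have "integral\<^sup>L lebesgue d = 0"
    unfolding integral_d by (simp add: p_def)
  then have "AE x in lebesgue. d x = 0"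
    using integral_nonneg_eq_0_iff_AE[OF int_d d_nonneg] by simp
  with feas'(5) have "AE x in lebesgue. \<phi> x = p x"
  proof eventually_elim
    case (elim x)
    then have "p x powr q + q * p x powr (q - 1) * (\<phi> x - p x) = \<phi> x powr q"
      using w_pos[of x] unfolding d_eq by auto
    then show ?case by (rule powr_tangent_le(2)[OF q(1) elim(1) p_pos])
  qed
  then show "AE x in lebesgue. \<phi> x = tsallis_density q \<Sigma> x"
    by (simp add: p_def)
qed

theorem lemma5:
  fixes \<Sigma> :: "real ^ 'n ^ 'n" and q :: real
  assumes "transpose \<Sigma> = \<Sigma>" and "pos_definite \<Sigma>"
    and "1 < q" and "q < 1 + 2 / real CARD('n)"
  shows "is_arg_max (objective q) (feasible q \<Sigma>) (tsallis_density q \<Sigma>) \<and>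
    (\<forall>\<phi>. is_arg_max (objective q) (feasible q \<Sigma>) \<phi> \<longrightarrow>
      (AE x in lebesgue. \<phi> x = tsallis_density q \<Sigma> x))"
proof (intro conjI allI impI)
  show "is_arg_max (objective q) (feasible q \<Sigma>) (tsallis_density q \<Sigma>)"
    using feasible_tsallis_density[OF assms] objective_tsallis_density_max(1)[OF assms]
    by (auto simp: is_arg_max_def not_less)
next
  fix \<phi> assume \<phi>: "is_arg_max (objective q) (feasible q \<Sigma>) \<phi>"
  then have feas: "feasible q \<Sigma> \<phi>" by (simp add: is_arg_max_def)
  \<comment> \<open>A maximizer excludes strictly larger feasible values; as the Tsallis density is
    feasible, this reverses the optimality inequality and forces equality.\<close>
  have "objective q (tsallis_density q \<Sigma>) \<le> objective q \<phi>"
    using \<phi> feasible_tsallis_density[OF assms] by (auto simp: is_arg_max_def not_less)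
  then show "AE x in lebesgue. \<phi> x = tsallis_density q \<Sigma> x"
    using objective_tsallis_density_max[OF assms feas] by simp
qed

end
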